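(* Let $\mathbf{A}\in\mathbb{F}^{m\times n}$ and let $\mathbf{A}_{\mathrm{CUR}}$ be a (fixed) rank-$r$ CUR approximation of $\mathbf{A}$ with selected row and column index sets $\mathcal{I}$ and $\mathcal{J}$, where $r<n$ and $\mathbf{A}\neq\mathbf{A}_{\mathrm{CUR}}$. Let $\mathcal{J}_q\subset\{1,\dots,n\}\setminus\mathcal{J}$ be a random set of $q$ extra column indices, and let $$\mathcal{S}:=\{\ell\in\{1,\dots,n\}:\ \|(\mathbf{A}-\mathbf{A}_{\mathrm{CUR}})\mathbf{e}_\ell\|_2>0\}$$ denote the support of the nonzero residual columns. Assume that $p_\ell:=\mathbb{P}(\ell\in\mathcal{J}_q)>0$ for every $\ell\in\mathcal{S}$, and set $w_\ell=p_\ell^{-1/2}$. Let $\mathbf{S}_q=\mathbf{W}\,\mathbf{I}(:,\mathcal{J}_q)$, where $\mathbf{W}$ is the $n\times n$ diagonal matrix with diagonal entries $w_\ell$. Then $$\frac{\|(\mathbf{A}-\mathbf{A}_{\mathrm{CUR}})\mathbf{S}_q\|_F^2-\mathbb{E}\big[\|(\mathbf{A}-\mathbf{A}_{\mathrm{CUR}})\mathbf{S}_q\|_F^2\big]}{\mathbb{E}\big[\|(\mathbf{A}-\mathbf{A}_{\mathrm{CUR}})\mathbf{S}_q\|_F^2\big]}\ \sim\ \mathrm{SG}\!\left(\frac{\max_{\ell\in\mathcal{S}}w_\ell^2}{2}\right).$$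
   Context: $\mathbb{F}$ is $\mathbb{R}$ or $\mathbb{C}$; $\|\cdot\|_F$ is the Frobenius norm and $\|\cdot\|_2$ the Euclidean norm; $\mathbf{e}_\ell$ is the $\ell$-th canonical basis vector of $\mathbb{F}^n$; $\mathbf{I}$ is the $n\times n$ identity matrix and $\mathbf{I}(:,\mathcal{J}_q)$ is its submatrix formed by the columns indexed by $\mathcal{J}_q$. CUR approximation: given a set $\mathcal{I}$ of $s$ row indices and a set $\mathcal{J}$ of $r$ column indices of $\mathbf{A}$ (indexing linearly independent rows, respectively columns), $\mathbf{A}_{\mathrm{CUR}}=\mathbf{A}(:,\mathcal{J})\,\mathbf{A}(\mathcal{I},\mathcal{J})^{\dagger}\,\mathbf{A}(\mathcal{I},:)$, where $\dagger$ denotes the Moore-Penrose pseudoinverse. All expectations and probabilities are conditional on the choice of $\mathbf{A}_{\mathrm{CUR}}$: the matrices $\mathbf{A}$, $\mathbf{A}_{\mathrm{CUR}}$ and the sets $\mathcal{I},\mathcal{J}$ are fixed, and the only randomness is in the set $\mathcal{J}_q$, which has $q$ elements and an arbitrary distribution subject to the stated condition. For $\ell\notin\mathcal{S}$ with $p_\ell=0$ the value $w_\ell$ is an arbitrary finite number; it plays no role since the corresponding residual column is zero. Sub-Gaussian: for a mean-zero real random variable $X$ and $\sigma>0$, $X\sim\mathrm{SG}(\sigma)$ means $\mathbb{E}[e^{tX}]\le e^{\sigma^2t^2/2}$ for all $t\in\mathbb{R}$. *)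

theory Defs
  imports
    "HOL-Probability.Probability"
    "Jordan_Normal_Form.Schur_Decomposition"
    "Jordan_Normal_Form.DL_Rank"
    "Jordan_Normal_Form.DL_Submatrix"
begin

text \<open>
  The scalar field is the real or the complex numbers. Every commutative normed division algebra
  over the reals is isometrically isomorphic to one of them (Gelfand-Mazur), and the axiom below
  pins \<^const>\<open>conjugate\<close> down to the usual conjugation. Nothing but the two instances is
  intended.
\<close>

class real_or_complex = real_normed_field + conjugatable_field +
  assumes mult_conjugate_eq_norm: "x * conjugate x = scaleR ((norm x)\<^sup>2) 1"

instance real :: real_or_complex
  by standard (simp add: power2_eq_square)

instance complex :: real_or_complex
  by standard (simp add: complex_norm_square scaleR_conv_of_real del: of_real_power)

definition euclidean_norm :: "'a :: real_normed_field Matrix.vec \<Rightarrow> real" where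
  "euclidean_norm v = sqrt (\<Sum>i<dim_vec v. (norm (vec_index v i))\<^sup>2)"

definition frobenius_norm :: "'a :: real_normed_field mat \<Rightarrow> real" where
  "frobenius_norm B = sqrt (\<Sum>i<dim_row B. \<Sum>j<dim_col B. (norm (B $$ (i, j)))\<^sup>2)"

definition is_pinv :: "'a :: conjugatable_field mat \<Rightarrow> 'a mat \<Rightarrow> bool" where
  "is_pinv B X \<longleftrightarrow>
     X \<in> carrier_mat (dim_col B) (dim_row B) \<and>
     B * X * B = B \<and> X * B * X = X \<and>
     mat_adjoint (B * X) = B * X \<and> mat_adjoint (X * B) = X * B"

definition pinv :: "'a :: conjugatable_field mat \<Rightarrow> 'a mat" where
  "pinv B = (THE X. is_pinv B X)"

lemma mat_adjoint_carrier:
  "B \<in> carrier_mat k l \<Longrightarrow> mat_adjoint B \<in> carrier_mat l k"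
  unfolding mat_adjoint_def by (auto simp: mat_of_rows_def)

lemma mat_adjoint_index:
  "B \<in> carrier_mat k l \<Longrightarrow> i < l \<Longrightarrow> j < k \<Longrightarrow> mat_adjoint B $$ (i, j) = conjugate (B $$ (j, i))"
  unfolding mat_adjoint_def by (auto simp: mat_of_rows_def)

lemma mat_adjoint_mult:
  assumes B: "B \<in> carrier_mat k l" and C: "C \<in> carrier_mat l p"
  shows "mat_adjoint (B * C) = mat_adjoint C * mat_adjoint B"
proof (rule eq_matI)
  have BC: "B * C \<in> carrier_mat k p" using B C by simp
  note car = mat_adjoint_carrier[OF B] mat_adjoint_carrier[OF C] mat_adjoint_carrier[OF BC]
  show "dim_row (mat_adjoint (B * C)) = dim_row (mat_adjoint C * mat_adjoint B)"
    and "dim_col (mat_adjoint (B * C)) = dim_col (mat_adjoint C * mat_adjoint B)"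
    using car by auto
  fix i j assume "i < dim_row (mat_adjoint C * mat_adjoint B)" "j < dim_col (mat_adjoint C * mat_adjoint B)"
  hence i: "i < p" and j: "j < k" using car by auto
  have "mat_adjoint (B * C) $$ (i, j) = conjugate (\<Sum>x<l. B $$ (j, x) * C $$ (x, i))"
    using mat_adjoint_index[OF BC i j] B C i j
    by (simp add: scalar_prod_def atLeast0LessThan)
  also have "\<dots> = (\<Sum>x<l. mat_adjoint C $$ (i, x) * mat_adjoint B $$ (x, j))"
    using mat_adjoint_index[OF B _ j] mat_adjoint_index[OF C i]
    by (simp add: sum_conjugate conjugate_dist_mul mult.commute)
  also have "\<dots> = (mat_adjoint C * mat_adjoint B) $$ (i, j)"
    using car i j by (simp add: scalar_prod_def atLeast0LessThan)
  finally show "mat_adjoint (B * C) $$ (i, j) = (mat_adjoint C * mat_adjoint B) $$ (i, j)" .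
qed

lemma is_pinv_unique:
  assumes X: "is_pinv B X" and Y: "is_pinv B Y"
  shows "X = Y"
proof -
  obtain k l where B: "B \<in> carrier_mat k l" by auto
  have cX: "X \<in> carrier_mat l k" and cY: "Y \<in> carrier_mat l k"
    using X Y B unfolding is_pinv_def by auto
  note as = assoc_mult_mat
  have eqX: "B * X * B = B" "X * B * X = X" "mat_adjoint (B * X) = B * X" "mat_adjoint (X * B) = X * B"
    and eqY: "B * Y * B = B" "Y * B * Y = Y" "mat_adjoint (B * Y) = B * Y" "mat_adjoint (Y * B) = Y * B"
    using X Y unfolding is_pinv_def by auto
  have BX: "B * X \<in> carrier_mat k k" and BY: "B * Y \<in> carrier_mat k k"
    and XB: "X * B \<in> carrier_mat l l" and YB: "Y * B \<in> carrier_mat l l"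
    using B cX cY by auto
  have "B * X = B * Y * (B * X)"
    using eqY(1) as[OF BY B cX] by simp
  also have "\<dots> = mat_adjoint (B * X * (B * Y))"
    using mat_adjoint_mult[OF BX BY] eqX(3) eqY(3) by simp
  also have "B * X * (B * Y) = B * Y"
    using eqX(1) as[OF BX B cY] by simp
  finally have 1: "B * X = B * Y" using eqY(3) by simp
  have "X * B = X * B * (Y * B)"
    using eqY(1) as[OF cX B YB] as[OF B cY B] by simp
  also have "\<dots> = mat_adjoint (Y * B * (X * B))"
    using mat_adjoint_mult[OF YB XB] eqX(4) eqY(4) by simp
  also have "Y * B * (X * B) = Y * B"
    using eqX(1) as[OF cY B XB] as[OF B cX B] by simp
  finally have 2: "X * B = Y * B" using eqY(4) by simp
  have "X = Y * B * X" using eqX(2) 2 by simp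
  also have "\<dots> = Y * (B * Y)" using as[OF cY B cX] 1 by simp
  also have "\<dots> = Y" using as[OF cY B cY] eqY(2) by simp
  finally show ?thesis .
qed

lemma pinv_eqI: "is_pinv B X \<Longrightarrow> pinv B = X"
  unfolding pinv_def by (blast intro: is_pinv_unique)

definition lin_indep_list :: "nat \<Rightarrow> 'a :: field Matrix.vec list \<Rightarrow> bool" where
  "lin_indep_list d vs \<longleftrightarrow>
     distinct vs \<and> \<not> module.lin_dep class_ring (module_vec TYPE('a) d) (set vs)"

text \<open>
  Indices start at 0, so row and column index sets are subsets of \<open>{..<m}\<close> and \<open>{..<n}\<close>.
  \<^term>\<open>submatrix A UNIV J\<close> keeps all rows.
\<close>

definition cur_matrix :: "'a :: conjugatable_field mat \<Rightarrow> nat set \<Rightarrow> nat set \<Rightarrow> 'a mat" where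
  "cur_matrix A I J = submatrix A UNIV J * pinv (submatrix A I J) * submatrix A I UNIV"

definition is_cur_approx ::
  "nat \<Rightarrow> 'a :: conjugatable_field mat \<Rightarrow> nat set \<Rightarrow> nat set \<Rightarrow> 'a mat \<Rightarrow> bool" where
  "is_cur_approx r A I J C \<longleftrightarrow>
     I \<subseteq> {..<dim_row A} \<and> J \<subseteq> {..<dim_col A} \<and> card J = r \<and>
     lin_indep_list (dim_col A) (rows (submatrix A I UNIV)) \<and>
     lin_indep_list (dim_row A) (cols (submatrix A UNIV J)) \<and>
     C = cur_matrix A I J \<and> vec_space.rank (dim_row A) C = r"

definition column_support :: "'a :: real_normed_field mat \<Rightarrow> nat set" where
  "column_support E =
     {l. l < dim_col E \<and> euclidean_norm (E *\<^sub>v unit_vec (dim_col E) l) > 0}"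

definition inclusion_prob :: "'w measure \<Rightarrow> ('w \<Rightarrow> nat set) \<Rightarrow> nat \<Rightarrow> real" where
  "inclusion_prob M K l = measure M {\<omega> \<in> space M. l \<in> K \<omega>}"

definition sampling_matrix :: "nat \<Rightarrow> (nat \<Rightarrow> real) \<Rightarrow> nat set \<Rightarrow> 'a :: real_normed_field mat" where
  "sampling_matrix n w K = mat_diag n (\<lambda>l. of_real (w l)) * submatrix (1\<^sub>m n) UNIV K"

definition sub_gaussian :: "'w measure \<Rightarrow> real \<Rightarrow> ('w \<Rightarrow> real) \<Rightarrow> bool" where
  "sub_gaussian M \<sigma> X \<longleftrightarrow>
     \<sigma> > 0 \<and> integrable M X \<and> integral\<^sup>L M X = 0 \<and>
     (\<forall>t::real. integrable M (\<lambda>\<omega>. exp (t * X \<omega>)) \<and>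
        integral\<^sup>L M (\<lambda>\<omega>. exp (t * X \<omega>)) \<le> exp (\<sigma>\<^sup>2 * t\<^sup>2 / 2))"

end

theory Submission
  imports Defs
begin

text \<open>
  The squared Frobenius norm of the sampled residual is the sum of \<open>w\<^sub>l\<^sup>2 a\<^sub>l\<close> over the sampled columns,
  where \<open>a\<^sub>l\<close> is the squared norm of the \<open>l\<close>-th residual column. Since \<open>p\<^sub>l w\<^sub>l\<^sup>2 = 1\<close> on the support,
  its mean is \<open>N = \<Sum> a\<^sub>l\<close>, the squared Frobenius norm of the residual. Divided by \<open>N\<close>, it takes
  values in \<open>[0, max w\<^sub>l\<^sup>2]\<close>, so Hoeffding's lemma for bounded variables gives the bound, whatever
  the dependence between the sampled columns.
\<close>

text \<open>Turns sums over column positions of a submatrix into sums over the selected indices.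
  Since \<open>pick K\<close> is strictly increasing below \<open>card K\<close>, it is injective
  there, and a subset of \<open>K\<close> with \<open>card K\<close> elements is all of
  \<open>K\<close>.\<close>

lemma bij_betw_pick:
  assumes "finite K"
  shows "bij_betw (pick K) {..<card K} K"
proof -
  have "inj_on (pick K) {..<card K}"
    by (rule linorder_inj_onI) (use pick_mono_le[of _ K] in force)+
  moreover have "pick K ` {..<card K} \<subseteq> K"
    using pick_in_set_le by auto
  ultimately show ?thesis
    using assms by (simp add: bij_betw_def card_image card_subset_eq)
qed

text \<open>Column \<open>j\<close> of the sampling matrix vanishes outside row
  \<open>pick K j\<close>, so the sum defining the product entry collapses to one term.\<close>

lemma mult_sampling_matrix_index:
  fixes E :: "'a :: real_normed_field mat"
  assumes E: "E \<in> carrier_mat m n" and K: "K \<subseteq> {..<n}" and i: "i < m" and j: "j < card K"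
  shows "(E * sampling_matrix n w K) $$ (i, j) = E $$ (i, pick K j) * of_real (w (pick K j))"
proof -
  \<comment> \<open>The dimension of a submatrix counts only the indices below \<open>n\<close>; as
    \<open>K\<close> lies in that range, it has exactly \<open>card K\<close> columns.\<close>
  have K': "{j. j < n \<and> j \<in> K} = K" using K by auto
  have pK: "pick K j < n" using pick_in_set_le[OF j] K by auto
  have sub: "submatrix (1\<^sub>m n) UNIV K \<in> carrier_mat n (card K)"
    by (rule carrier_matI) (simp_all add: dim_submatrix K')
  have entry: "sampling_matrix n w K $$ (k, j) = (if k = pick K j then of_real (w (pick K j)) else 0 :: 'a)"
    if "k < n" for k
  proof -
    have "(submatrix (1\<^sub>m n) UNIV K :: 'a mat) $$ (k, j) = 1\<^sub>m n $$ (k, pick K j)"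
      using that j by (subst submatrix_index) (simp_all add: K' pick_UNIV)
    then show ?thesis
      using that j pK unfolding sampling_matrix_def mat_diag_mult_left[OF sub] by simp
  qed
  have "(sampling_matrix n w K :: 'a mat) \<in> carrier_mat n (card K)"
    unfolding sampling_matrix_def using mult_carrier_mat[OF mat_diag_dim sub] .
  then have "(E * sampling_matrix n w K) $$ (i, j) = (\<Sum>k<n. E $$ (i, k) * sampling_matrix n w K $$ (k, j))"
    using E i j by (simp add: scalar_prod_def atLeast0LessThan)
  also have "\<dots> = (\<Sum>k<n. if k = pick K j then E $$ (i, k) * of_real (w (pick K j)) else 0)"
    by (intro sum.cong) (simp_all add: entry)
  finally show ?thesis
    using pK by simp
qed

lemma frobenius_norm_mult_sampling_matrix:
  fixes E :: "'a :: real_normed_field mat"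
  assumes E: "E \<in> carrier_mat m n" and K: "K \<subseteq> {..<n}"
  shows "(frobenius_norm (E * sampling_matrix n w K))\<^sup>2 =
    (\<Sum>l\<in>K. (w l)\<^sup>2 * (euclidean_norm (col E l))\<^sup>2)"
proof -
  have K': "{j. j < n \<and> j \<in> K} = K" using K by auto
  have dims: "dim_row (E * sampling_matrix n w K) = m"
    "dim_col (E * sampling_matrix n w K) = card K"
    using E by (simp_all add: sampling_matrix_def dim_submatrix K')
  have "(frobenius_norm (E * sampling_matrix n w K))\<^sup>2 =
      (\<Sum>i<m. \<Sum>j<card K. (norm ((E * sampling_matrix n w K) $$ (i, j)))\<^sup>2)"
    unfolding frobenius_norm_def dims by (simp add: sum_nonneg)
  also have "\<dots> = (\<Sum>i<m. \<Sum>j<card K. (w (pick K j))\<^sup>2 * (norm (E $$ (i, pick K j)))\<^sup>2)"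
    by (intro sum.cong refl)
      (simp add: mult_sampling_matrix_index[OF E K] norm_mult power_mult_distrib mult.commute
        del: index_mult_mat)
  also have "\<dots> = (\<Sum>j<card K. (w (pick K j))\<^sup>2 * (\<Sum>i<m. (norm (E $$ (i, pick K j)))\<^sup>2))"
    by (subst sum.swap) (simp add: sum_distrib_left)
  also have "\<dots> = (\<Sum>l\<in>K. (w l)\<^sup>2 * (\<Sum>i<m. (norm (E $$ (i, l)))\<^sup>2))"
    using K finite_subset by (intro sum.reindex_bij_betw bij_betw_pick) auto
  also have "\<dots> = (\<Sum>l\<in>K. (w l)\<^sup>2 * (euclidean_norm (col E l))\<^sup>2)"
  proof (intro sum.cong refl)
    fix l assume "l \<in> K"
    then show "(w l)\<^sup>2 * (\<Sum>i<m. (norm (E $$ (i, l)))\<^sup>2) = (w l)\<^sup>2 * (euclidean_norm (col E l))\<^sup>2"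
      using K E by (auto simp: euclidean_norm_def sum_nonneg)
  qed
  finally show ?thesis .
qed

lemma mult_unit_vec_eq_col:
  fixes E :: "'a :: comm_ring_1 mat"
  assumes "E \<in> carrier_mat m n" "l < n"
  shows "E *\<^sub>v unit_vec n l = col E l"
  using assms by (intro eq_vecI) auto

lemma column_support_eq:
  assumes "E \<in> carrier_mat m n"
  shows "column_support E = {l. l < n \<and> euclidean_norm (col E l) > 0}"
  using assms mult_unit_vec_eq_col[OF assms] by (auto simp: column_support_def)

lemma euclidean_norm_nonneg: "euclidean_norm v \<ge> 0"
  by (simp add: euclidean_norm_def sum_nonneg)

lemma euclidean_norm_pos:
  assumes "i < dim_vec v" "vec_index v i \<noteq> 0"
  shows "euclidean_norm v > 0"
  unfolding euclidean_norm_def real_sqrt_gt_0_iff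
  using assms by (intro sum_pos2[of _ i]) auto

text \<open>An entry where the matrices differ makes its residual column nonzero. This keeps
  \<open>Max\<close> over the support meaningful and the normalising mean positive.\<close>

lemma column_support_nonempty:
  fixes A B :: "'a :: real_normed_field mat"
  assumes A: "A \<in> carrier_mat m n" and B: "B \<in> carrier_mat m n" and "A \<noteq> B"
  shows "column_support (A - B) \<noteq> {}"
proof -
  have "\<exists>i<m. \<exists>j<n. A $$ (i, j) \<noteq> B $$ (i, j)"
  proof (rule ccontr)
    assume "\<not> ?thesis"
    then have "A = B" using A B by (intro eq_matI) auto
    then show False using \<open>A \<noteq> B\<close> by contradiction
  qed
  then obtain i j where ij: "i < m" "j < n" "A $$ (i, j) \<noteq> B $$ (i, j)"
    by blast
  then have "euclidean_norm (col (A - B) j) > 0"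
    using A B by (intro euclidean_norm_pos[of i]) auto
  then show ?thesis
    using ij column_support_eq[OF minus_carrier_mat[OF B, of A]] by auto
qed

text \<open>The outer factors of a product fix its dimensions, so \<open>pinv\<close> can stay
  opaque.\<close>

lemma cur_matrix_carrier:
  assumes "A \<in> carrier_mat m n"
  shows "cur_matrix A I J \<in> carrier_mat m n"
  using assms by (auto simp: cur_matrix_def dim_submatrix)

text \<open>Hoeffding's lemma as a bound on a nonnegative extended integral already contains
  integrability: its right side is finite. The bound then passes to the Bochner integral.\<close>

lemma (in interval_bounded_random_variable) Hoeffdings_lemma_pos:
  assumes "t > 0"
  shows "integrable M (\<lambda>x. exp (t * (f x - expectation f)))"
    and "expectation (\<lambda>x. exp (t * (f x - expectation f))) \<le> exp (((b - a) / 2)\<^sup>2 * t\<^sup>2 / 2)"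
proof -
  have meas: "(\<lambda>x. exp (t * (f x - expectation f))) \<in> borel_measurable M"
    by measurable
  \<comment> \<open>Hoeffding's exponent \<open>t\<^sup>2 * (b - a)\<^sup>2 / 8\<close> is rewritten
    with the sub-Gaussian parameter \<open>(b - a) / 2\<close>.\<close>
  have le: "(\<integral>\<^sup>+ x. ennreal (exp (t * (f x - expectation f))) \<partial>M)
      \<le> ennreal (exp (((b - a) / 2)\<^sup>2 * t\<^sup>2 / 2))"
    using Hoeffdings_lemma_nn_integral[OF assms]
    by (simp add: power_divide mult.commute)
  then have "(\<integral>\<^sup>+ x. ennreal (exp (t * (f x - expectation f))) \<partial>M) < \<infinity>"
    unfolding infinity_ennreal_def using ennreal_less_top by (rule le_less_trans)
  then show int: "integrable M (\<lambda>x. exp (t * (f x - expectation f)))"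
    by (intro integrableI_nonneg meas) auto
  show "expectation (\<lambda>x. exp (t * (f x - expectation f))) \<le> exp (((b - a) / 2)\<^sup>2 * t\<^sup>2 / 2)"
    using le by (subst (asm) nn_integral_eq_integral[OF int]) auto
qed

lemma (in interval_bounded_random_variable) sub_gaussian_centered:
  assumes "a < b"
  shows "sub_gaussian M ((b - a) / 2) (\<lambda>x. f x - expectation f)"
proof -
  \<comment> \<open>Negative \<open>t\<close> reduces to positive \<open>- t\<close> by reflection:
    \<open>- f\<close> lies in an interval of the same length, and the two sign changes cancel in
    the exponent.\<close>
  interpret neg: interval_bounded_random_variable M "\<lambda>x. - f x" "- b" "- a"
    by unfold_locales (use AE_in_interval in auto)
  have "integrable M (\<lambda>x. exp (t * (f x - expectation f))) \<and>
      expectation (\<lambda>x. exp (t * (f x - expectation f))) \<le> exp (((b - a) / 2)\<^sup>2 * t\<^sup>2 / 2)" for t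
  proof (cases t "0 :: real" rule: linorder_cases)
    case less
    then show ?thesis
      using neg.Hoeffdings_lemma_pos[of "- t"] by (simp add: algebra_simps)
  next
    case equal
    then show ?thesis by (simp add: prob_space)
  next
    case greater
    then show ?thesis using Hoeffdings_lemma_pos by blast
  qed
  then show ?thesis
    using assms integrable expectation_shift by (simp add: sub_gaussian_def)
qed

theorem theorem2:
  fixes A A\<^sub>C\<^sub>U\<^sub>R :: "'a :: real_or_complex mat"
    and I J :: "nat set"
    and m n r q :: nat
    and M :: "'w measure"
    and J\<^sub>q :: "'w \<Rightarrow> nat set"
    and w :: "nat \<Rightarrow> real"
  defines "S \<equiv> column_support (A - A\<^sub>C\<^sub>U\<^sub>R)"
  assumes "A \<in> carrier_mat m n"
    and "is_cur_approx r A I J A\<^sub>C\<^sub>U\<^sub>R"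
    and "r < n"
    and "A \<noteq> A\<^sub>C\<^sub>U\<^sub>R"
    and "prob_space M"
    and "J\<^sub>q \<in> M \<rightarrow>\<^sub>M count_space UNIV"
    and "\<And>\<omega>. \<omega> \<in> space M \<Longrightarrow> J\<^sub>q \<omega> \<subseteq> {..<n} - J \<and> card (J\<^sub>q \<omega>) = q"
    and "\<And>l. l \<in> S \<Longrightarrow> inclusion_prob M J\<^sub>q l > 0"
    and "\<And>l. l < n \<Longrightarrow> inclusion_prob M J\<^sub>q l > 0 \<Longrightarrow>
           w l = inclusion_prob M J\<^sub>q l powr (- 1 / 2)"
  shows "sub_gaussian M (Max ((\<lambda>l. (w l)\<^sup>2) ` S) / 2)
    (\<lambda>\<omega>.
      ((frobenius_norm ((A - A\<^sub>C\<^sub>U\<^sub>R) * sampling_matrix n w (J\<^sub>q \<omega>)))\<^sup>2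
        - integral\<^sup>L M (\<lambda>\<eta>. (frobenius_norm ((A - A\<^sub>C\<^sub>U\<^sub>R) * sampling_matrix n w (J\<^sub>q \<eta>)))\<^sup>2))
      / integral\<^sup>L M (\<lambda>\<eta>. (frobenius_norm ((A - A\<^sub>C\<^sub>U\<^sub>R) * sampling_matrix n w (J\<^sub>q \<eta>)))\<^sup>2))"
proof -
  interpret prob_space M by fact
  define E where "E = A - A\<^sub>C\<^sub>U\<^sub>R"
  define a where "a l = (euclidean_norm (col E l))\<^sup>2" for l
  define p where "p = inclusion_prob M J\<^sub>q"
  define F where "F \<omega> = (frobenius_norm (E * sampling_matrix n w (J\<^sub>q \<omega>)))\<^sup>2" for \<omega>
  define N where "N = (\<Sum>l<n. a l)"
  define W where "W = Max ((\<lambda>l. (w l)\<^sup>2) ` S)"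
  have C: "A\<^sub>C\<^sub>U\<^sub>R \<in> carrier_mat m n"
    using assms(3) cur_matrix_carrier[OF assms(2)] by (simp add: is_cur_approx_def)
  have E: "E \<in> carrier_mat m n"
    unfolding E_def using C by (rule minus_carrier_mat)
  have S: "S = {l. l < n \<and> a l > 0}"
    unfolding S_def E_def[symmetric] column_support_eq[OF E] a_def
    using euclidean_norm_nonneg by (auto simp: zero_less_power2 less_le)
  have a_nonneg: "a l \<ge> 0" for l by (simp add: a_def)
  have "S \<noteq> {}"
    unfolding S_def using column_support_nonempty[OF assms(2) C assms(5)] .
  then obtain k where k: "k \<in> S" by blast
  have finS: "finite S" unfolding S by simp
  have N: "N > 0"
    unfolding N_def using k S a_nonneg by (intro sum_pos2[of _ k]) auto
  have p_pos: "p l > 0" if "l \<in> S" for l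
    using assms(9)[OF that] by (simp add: p_def)
  have w2: "(w l)\<^sup>2 = 1 / p l" if "l \<in> S" for l
  proof -
    have "w l = p l powr (- 1 / 2)"
      using that assms(9,10) S by (auto simp: p_def)
    then have "(w l)\<^sup>2 = p l powr (- 1)"
      by (simp add: power2_eq_square powr_add[symmetric])
    then show ?thesis
      using p_pos[OF that] by (simp add: powr_minus_divide)
  qed
  have w_le: "(w l)\<^sup>2 \<le> W" if "l \<in> S" for l
    unfolding W_def using finS that by (intro Max_ge) auto
  have "W > 0"
    using w_le[OF k] w2[OF k] p_pos[OF k] by (metis less_le_trans zero_less_divide_1_iff)
  \<comment> \<open>Off the support \<open>a l = 0\<close>, so both sides vanish whatever the value
    of \<open>w l\<close>; hence the bound covers every column and not only those in
    \<open>S\<close>.\<close>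
  have wa_le: "(w l)\<^sup>2 * a l \<le> W * a l" if "l < n" for l
    using that w_le[of l] a_nonneg[of l] S by (cases "a l = 0") (auto intro!: mult_right_mono)
  have J: "J\<^sub>q \<omega> \<subseteq> {..<n}" if "\<omega> \<in> space M" for \<omega>
    using assms(8)[OF that] by auto
  have F: "F \<omega> = (\<Sum>l\<in>J\<^sub>q \<omega>. (w l)\<^sup>2 * a l)" if "\<omega> \<in> space M" for \<omega>
    unfolding F_def a_def using frobenius_norm_mult_sampling_matrix[OF E J[OF that]] .
  \<comment> \<open>Index sets carry the discrete sigma-algebra, so every real function of them is
    measurable.\<close>
  have F_meas: "F \<in> borel_measurable M"
    unfolding F_def
    by (rule measurable_compose[OF assms(7), of "\<lambda>K. (frobenius_norm (E * sampling_matrix n w K))\<^sup>2"]) simp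
  have F_nonneg: "F \<omega> \<ge> 0" for \<omega> by (simp add: F_def)
  \<comment> \<open>Each weight is replaced by \<open>W\<close>, then the sum is enlarged from the
    sampled columns to all columns, which only adds nonnegative terms.\<close>
  have F_le: "F \<omega> \<le> W * N" if "\<omega> \<in> space M" for \<omega>
  proof -
    have "F \<omega> \<le> (\<Sum>l\<in>J\<^sub>q \<omega>. W * a l)"
      unfolding F[OF that] using J[OF that] by (intro sum_mono wa_le) auto
    also have "\<dots> \<le> (\<Sum>l<n. W * a l)"
      using J[OF that] \<open>W > 0\<close> a_nonneg by (intro sum_mono2) auto
    finally show ?thesis by (simp add: N_def sum_distrib_left)
  qed
  have EF: "expectation F = N"
  proof -
    have ev: "{\<omega> \<in> space M. l \<in> J\<^sub>q \<omega>} \<in> sets M" for l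
      using measurable_sets[OF assms(7), of "{K. l \<in> K}"] by (simp add: vimage_def Int_def conj_commute)
    \<comment> \<open>Indicators turn the sum over a random set into one over the fixed range
      \<open>{..<n}\<close>. Linearity of expectation then applies without any independence.\<close>
    have "expectation F =
        expectation (\<lambda>\<omega>. \<Sum>l<n. indicat_real {\<omega> \<in> space M. l \<in> J\<^sub>q \<omega>} \<omega> * ((w l)\<^sup>2 * a l))"
    proof (rule Bochner_Integration.integral_cong[OF refl])
      fix \<omega> assume \<omega>: "\<omega> \<in> space M"
      have "F \<omega> = (\<Sum>l\<in>{..<n} \<inter> J\<^sub>q \<omega>. (w l)\<^sup>2 * a l)"
        using F[OF \<omega>] J[OF \<omega>] by (simp add: Int_absorb1)
      also have "\<dots> = (\<Sum>l<n. indicat_real {\<omega> \<in> space M. l \<in> J\<^sub>q \<omega>} \<omega> * ((w l)\<^sup>2 * a l))"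
        using \<omega> by (auto simp: sum.inter_restrict indicator_def intro!: sum.cong)
      finally show "F \<omega> = \<dots>" .
    qed
    also have "\<dots> = (\<Sum>l<n. p l * ((w l)\<^sup>2 * a l))"
    proof (subst Bochner_Integration.integral_sum)
      show "integrable M (\<lambda>\<omega>. indicat_real {\<omega> \<in> space M. l \<in> J\<^sub>q \<omega>} \<omega> * ((w l)\<^sup>2 * a l))" for l
        using ev[of l] by (intro integrable_mult_left integrable_real_indicator) (auto simp: less_top[symmetric])
      have "expectation (\<lambda>\<omega>. indicat_real {\<omega> \<in> space M. l \<in> J\<^sub>q \<omega>} \<omega> * ((w l)\<^sup>2 * a l))
          = p l * ((w l)\<^sup>2 * a l)" for l
        using ev[of l] by (simp add: p_def inclusion_prob_def Int_absorb1 del: indicator_simps)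
      then show "(\<Sum>l<n. expectation (\<lambda>\<omega>. indicat_real {\<omega> \<in> space M. l \<in> J\<^sub>q \<omega>} \<omega> * ((w l)\<^sup>2 * a l)))
          = (\<Sum>l<n. p l * ((w l)\<^sup>2 * a l))"
        by (intro sum.cong refl)
    qed
    also have "\<dots> = N"
      unfolding N_def
    proof (intro sum.cong refl)
      fix l assume "l \<in> {..<n}"
      \<comment> \<open>On \<open>S\<close> the weight cancels the inclusion probability; elsewhere
        \<open>a l = 0\<close>.\<close>
      then show "p l * ((w l)\<^sup>2 * a l) = a l"
        using w2[of l] p_pos[of l] a_nonneg[of l] S by (cases "l \<in> S") (auto simp: less_le)
    qed
    finally show ?thesis .
  qed
  \<comment> \<open>Dividing by \<open>N\<close> before applying Hoeffding's lemma makes the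
    interval length \<open>W\<close>, which gives the parameter \<open>W / 2\<close>
    directly.\<close>
  interpret interval_bounded_random_variable M "\<lambda>\<omega>. F \<omega> / N" 0 W
  proof unfold_locales
    show "random_variable borel (\<lambda>\<omega>. F \<omega> / N)" using F_meas by measurable
    show "AE \<omega> in M. F \<omega> / N \<in> {0..W}"
      using N F_nonneg F_le by (auto simp: divide_simps)
  qed
  have "(\<lambda>\<omega>. F \<omega> / N - expectation (\<lambda>\<omega>. F \<omega> / N)) = (\<lambda>\<omega>. (F \<omega> - expectation F) / expectation F)"
    by (simp add: EF diff_divide_distrib)
  then have "sub_gaussian M (W / 2) (\<lambda>\<omega>. (F \<omega> - expectation F) / expectation F)"
    using sub_gaussian_centered[OF \<open>W > 0\<close>] by simp
  then show ?thesis
    unfolding W_def F_def E_def .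
qed

end
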